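(* Let $X$ be an absolutely continuous random variable with density $p \in \mathcal{G}$. Let $Y$ be another absolutely continuous (real) random variable. Then $\mathrm{E}[\mathcal{T}_pf(Y)]=0$ for all $f \in \mathcal{F}(p)$ if, and only if, either $\mathrm{P}(Y\in S_p)=0$, or $\mathrm{P}(Y\in S_p)>0$ and $$\mathrm{P}\left(Y \le z \,\middle|\, Y \in S_p\right) = \mathrm{P}(X \le z)\quad\text{for all } z\in S_p.$$
   Context: $\mathcal{G}$ is the collection of positive real functions $x\mapsto p(x)$ such that (i) the support $S_p := \{x \in \mathbb{R} : p(x) \text{ (exists and) is positive}\}$ is an interval with closure $\bar S_p=[a,b]$ for some $-\infty\le a<b\le\infty$; (ii) $p$ is differentiable (in the usual sense) at every point of $(a,b)$, with derivative $p'$; (iii) $\int_{S_p}p(y)\,dy=1$. Convention: $\frac{1}{p(x)}$ is understood to be $0$ when $x\notin S_p$. For $p\in\mathcal{G}$ with $\bar S_p=[a,b]$, the class of test functions $\mathcal{F}(p)$ is the collection of functions $f:\mathbb{R}\to\mathbb{R}$ such that $x\mapsto f(x)p(x)$ is differentiable on the interior of $S_p$ and $f(a^+)p(a^+)=f(b^-)p(b^-)=0$ (that is, $f(x)p(x)\to 0$ as $x\to a^+$ and as $x\to b^-$). The Stein operator $\mathcal{T}_p$ maps $f\in\mathcal{F}(p)$ to the function $\mathcal{T}_pf:\mathbb{R}\to\mathbb{R}$, $\mathcal{T}_pf(x):=\frac{1}{p(x)}\left.\frac{d}{dy}(f(y)p(y))\right|_{y=x}$ (hence $\mathcal{T}_pf(x)=0$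 for $x\notin S_p$).
   Formalization: The condition E[T_p f(Y)] = 0 is required only for those f in F(p) for which T_p f(Y) is integrable, since F(p) contains f for which this expectation does not exist, even when Y = X. *)

theory Defs
  imports "HOL-Probability.Probability"
begin

(* A point at which the density is left undefined is represented by a point where p has the
   value 0: it does not belong to the support either way. *)
definition dens_support :: "(real \<Rightarrow> real) \<Rightarrow> real set" where
  "dens_support p = {x. p x > 0}"

(* The closure of the support is the interval [a,b]; infinite endpoints are allowed. As a < b,
   the endpoints a and b are uniquely determined by p. *)
definition support_endpoints :: "(real \<Rightarrow> real) \<Rightarrow> ereal \<Rightarrow> ereal \<Rightarrow> bool" where
  "support_endpoints p a b \<longleftrightarrow>
     a < b \<and> closure (dens_support p) = {x. a \<le> ereal x \<and> ereal x \<le> b}"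

(* "Positive function" means nonnegative here: the support is a proper subset of the real line
   in general. A Bochner integral equal to 1 entails integrability. *)
definition density_class :: "(real \<Rightarrow> real) set" where
  "density_class = {p.
     (\<forall>x. 0 \<le> p x) \<and>
     is_interval (dens_support p) \<and>
     (\<exists>a b. support_endpoints p a b \<and>
        (\<forall>x. a < ereal x \<and> ereal x < b \<longrightarrow> p differentiable (at x))) \<and>
     (LINT y:dens_support p|lborel. p y) = 1}"

(* The one-sided limits are taken along filters on the extended reals, as in the library's
   interval integrals, so that a = -\<infinity> and b = \<infinity> give limits at minus and plus infinity. *)
definition test_class :: "(real \<Rightarrow> real) \<Rightarrow> (real \<Rightarrow> real) set" where
  "test_class p = {f.
     (\<forall>x \<in> interior (dens_support p). (\<lambda>y. f y * p y) differentiable (at x)) \<and>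
     (\<exists>a b. support_endpoints p a b \<and>
        (((\<lambda>x. f x * p x) \<circ> real_of_ereal) \<longlongrightarrow> 0) (at_right a) \<and>
        (((\<lambda>x. f x * p x) \<circ> real_of_ereal) \<longlongrightarrow> 0) (at_left b))}"

(* The first factor is 1/p with the convention that it vanishes off the support. At an endpoint
   of the support that belongs to the support, the derivative need not exist and the value is
   unspecified; this concerns at most two points. *)
definition stein_op :: "(real \<Rightarrow> real) \<Rightarrow> (real \<Rightarrow> real) \<Rightarrow> real \<Rightarrow> real" where
  "stein_op p f x =
     (if x \<in> dens_support p then 1 / p x else 0) * deriv (\<lambda>y. f y * p y) x"

end

theory Submission
  imports Defs
begin

text \<open>
  Write \<open>S\<close> for the support of \<open>p\<close>, \<open>P\<close> for the law with density \<open>p\<close> and \<open>Q\<close> for the law of \<open>Y\<close>.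
  Since \<open>T\<^sub>p f\<close> vanishes off \<open>S\<close>, its mean under \<open>Q\<close> only depends on \<open>Q\<close> conditioned on \<open>S\<close>,
  which is \<open>uniform_measure Q S\<close>. The heart of the matter is therefore that, when \<open>Q S > 0\<close>, all
  the means \<open>E\<^sub>Q[T\<^sub>p f]\<close> that exist vanish exactly if this conditional law is \<open>P\<close> (\<open>stein_characterization\<close>).

  If the conditional law is \<open>P\<close>, then up to a constant factor the mean is
  \<open>\<integral> p T\<^sub>p f = \<integral> (f p)'\<close> over the interior \<open>(a, b)\<close> of \<open>S\<close>, and this is zero because \<open>f p\<close> vanishes
  at both ends (\<open>stein_identity\<close>). The derivative \<open>(f p)'\<close> is integrable but need not be continuous;
  the fundamental theorem holds nevertheless on compact subintervals by way of the
  Henstock-Kurzweil integral (\<open>integral_derivative_einterval\<close>).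

  For the converse one would like to solve \<open>T\<^sub>p f = 1\<^bsub>(-\<infinity>,z]\<^esub> - P(X \<le> z)\<close>. For \<open>z\<close> in the
  interior of \<open>S\<close>, however, the product of the solution with \<open>p\<close> has a kink at \<open>z\<close>, so the
  solution is not a test function. But for a bounded continuous \<open>h\<close> the function
  \<open>f x = (1 / p x) \<integral>\<^bsub>u \<le> x\<^esub> (h u - E[h X]) p u\<close> is one, and it solves
  \<open>T\<^sub>p f = h - E[h X]\<close> in the interior of \<open>S\<close> (\<open>stein_equation_solution\<close>); as
  \<open>Q\<close> is absolutely continuous, the two endpoints do not matter. Hence \<open>P\<close> and the conditional
  law integrate all continuous approximations of indicators of half-lines alike, and coincide
  (\<open>real_distribution_eqI_cts_step\<close>).

  Finally, both laws are concentrated on the interval \<open>S\<close>, so comparing their distribution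
  functions at the points of \<open>S\<close> is enough (\<open>real_distribution_eqI_on_interval\<close>).
\<close>

section \<open>Densities and their supports\<close>

lemma density_class_integral:
  assumes "p \<in> density_class"
  shows "integrable lborel p" and "(LINT y|lborel. p y) = 1"
proof -
  have eq: "(\<lambda>y. indicator (dens_support p) y *\<^sub>R p y) = p"
    using assms
    by (auto simp: fun_eq_iff density_class_def dens_support_def indicator_def not_less
             intro: antisym)
  have int: "(LINT y:dens_support p|lborel. p y) = 1"
    using assms by (simp add: density_class_def)
  then show "(LINT y|lborel. p y) = 1"
    by (simp only: set_lebesgue_integral_def eq)
  then show "integrable lborel p"
    using not_integrable_integral_eq by fastforce
qed

lemma density_class_measurable [measurable_dest]:
  assumes "p \<in> density_class"
  shows "p \<in> borel_measurable borel"
  using density_class_integral(1)[OF assms] by auto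

lemma dens_support_measurable:
  assumes "p \<in> density_class"
  shows "dens_support p \<in> sets borel"
  unfolding dens_support_def
  using density_class_measurable[OF assms] by measurable

text \<open>
  A convex set has the same interior as its closure, so the endpoints of the closure determine
  the interior whether or not they belong to the support.
\<close>
lemma interior_dens_support:
  assumes "p \<in> density_class" and ab: "support_endpoints p a b"
  shows "interior (dens_support p) = einterval a b"
proof -
  have "convex (dens_support p)"
    using assms by (simp add: density_class_def is_interval_convex)
  then have "interior (dens_support p) = interior {x. a \<le> ereal x \<and> ereal x \<le> b}"
    using ab by (simp add: support_endpoints_def flip: convex_interior_closure)
  also have "\<dots> = einterval a b"
  proof (intro equalityI subsetI)
    fix x assume "x \<in> interior {x. a \<le> ereal x \<and> ereal x \<le> b}"
    then obtain e where e: "e > 0" "cball x e \<subseteq> {x. a \<le> ereal x \<and> ereal x \<le> b}"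
      unfolding mem_interior_cball by blast
    then have "x - e \<in> {x. a \<le> ereal x \<and> ereal x \<le> b}" "x + e \<in> {x. a \<le> ereal x \<and> ereal x \<le> b}"
      by (auto simp: subset_iff dist_real_def)
    moreover have "ereal (x - e) < ereal x" "ereal x < ereal (x + e)"
      using e by auto
    ultimately show "x \<in> einterval a b"
      unfolding einterval_iff by (blast intro: le_less_trans less_le_trans)
  next
    fix x assume "x \<in> einterval a b"
    then show "x \<in> interior {x. a \<le> ereal x \<and> ereal x \<le> b}"
      by (intro interiorI[of "einterval a b"]) (auto simp: einterval_iff)
  qed
  finally show ?thesis .
qed

text \<open>
  Only on this set is the value of \<open>T\<^sub>p f\<close> arbitrary. As it is finite, it affects neither
  measurability nor integrals with respect to absolutely continuous laws.
\<close>
lemma finite_dens_support_boundary: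
  assumes "p \<in> density_class"
  shows "finite (dens_support p - interior (dens_support p))"
proof -
  obtain a b where ab: "support_endpoints p a b"
    using assms by (auto simp: density_class_def)
  have "dens_support p - interior (dens_support p) \<subseteq> {real_of_ereal a, real_of_ereal b}"
  proof
    fix x assume x: "x \<in> dens_support p - interior (dens_support p)"
    then have "a \<le> ereal x" "ereal x \<le> b"
      using ab closure_subset[of "dens_support p"] by (auto simp: support_endpoints_def)
    moreover have "\<not> (a < ereal x \<and> ereal x < b)"
      using x interior_dens_support[OF assms ab] by (auto simp: einterval_iff)
    ultimately have "a = ereal x \<or> b = ereal x"
      by auto
    then show "x \<in> {real_of_ereal a, real_of_ereal b}"
      by auto
  qed
  then show ?thesis
    by (rule finite_subset) simp
qed

lemma real_distribution_density_class:
  assumes p: "p \<in> density_class"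
  shows "real_distribution (density lborel (\<lambda>x. ennreal (p x)))"
    and "measure (density lborel (\<lambda>x. ennreal (p x))) (dens_support p) = 1"
proof -
  note [measurable] = density_class_measurable[OF p] dens_support_measurable[OF p]
  have nonneg: "0 \<le> p x" for x
    using p by (simp add: density_class_def)
  have tot: "(\<integral>\<^sup>+x. ennreal (p x) \<partial>lborel) = 1"
    using density_class_integral[OF p] nonneg by (subst nn_integral_eq_integral) auto
  have "prob_space (density lborel (\<lambda>x. ennreal (p x)))"
    by (intro prob_spaceI) (simp add: emeasure_density tot)
  then show "real_distribution (density lborel (\<lambda>x. ennreal (p x)))"
    by (simp add: real_distribution_def real_distribution_axioms_def)
  have "(\<integral>\<^sup>+x. ennreal (p x) * indicator (dens_support p) x \<partial>lborel) = (\<integral>\<^sup>+x. ennreal (p x) \<partial>lborel)"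
    by (intro nn_integral_cong) (auto simp: indicator_def dens_support_def not_less ennreal_neg)
  then show "measure (density lborel (\<lambda>x. ennreal (p x))) (dens_support p) = 1"
    by (simp add: measure_def emeasure_density tot)
qed

section \<open>Measurability of the Stein operator\<close>

text \<open>
  A derivative is a pointwise limit of difference quotients. These are formed for the product of
  \<open>F\<close> with the indicator of \<open>S\<close>, because \<open>F\<close> is not known to be measurable off \<open>S\<close>; as \<open>S\<close> is
  open, this does not change the limit at a point of \<open>S\<close>.
\<close>
lemma measurable_deriv_on_open:
  fixes F :: "real \<Rightarrow> real"
  assumes "open S" and diff: "\<And>x. x \<in> S \<Longrightarrow> F differentiable (at x)"
  shows "(\<lambda>x. indicator S x * deriv F x) \<in> borel_measurable borel"
proof -
  have [measurable]: "S \<in> sets borel"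
    using \<open>open S\<close> by simp
  define G where "G = (\<lambda>x. indicator S x *\<^sub>R F x)"
  have [measurable]: "G \<in> borel_measurable borel"
    unfolding G_def
    by (intro borel_measurable_continuous_on_indicator)
       (auto intro!: continuous_at_imp_continuous_on differentiable_imp_continuous_within diff)
  define q where "q = (\<lambda>n x. indicator S x * ((G (x + 1 / real (Suc n)) - G x) / (1 / real (Suc n))))"
  show ?thesis
  proof (rule borel_measurable_LIMSEQ_real[of _ q])
    show "q n \<in> borel_measurable borel" for n
      unfolding q_def by measurable
    fix x :: real
    show "(\<lambda>n. q n x) \<longlonglongrightarrow> indicator S x * deriv F x"
    proof (cases "x \<in> S")
      case True
      have "(F has_real_derivative deriv F x) (at x)"
        using diff[OF True] by (simp add: DERIV_deriv_iff_real_differentiable)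
      then have "(G has_real_derivative deriv F x) (at x)"
        by (rule has_field_derivative_transform_within_open[OF _ \<open>open S\<close> True])
           (simp add: G_def)
      then have "((\<lambda>h. (G (x + h) - G x) / h) \<longlongrightarrow> deriv F x) (at 0)"
        by (simp add: DERIV_def)
      moreover have "filterlim (\<lambda>n. 1 / real (Suc n)) (at 0) sequentially"
        unfolding filterlim_at using LIMSEQ_inverse_real_of_nat by (simp add: inverse_eq_divide)
      ultimately have "(\<lambda>n. (G (x + 1 / real (Suc n)) - G x) / (1 / real (Suc n))) \<longlonglongrightarrow> deriv F x"
        by (rule filterlim_compose)
      with True show ?thesis
        by (simp add: q_def)
    qed (simp add: q_def)
  qed
qed

lemma stein_op_measurable:
  assumes p: "p \<in> density_class" and f: "f \<in> test_class p"
  shows "stein_op p f \<in> borel_measurable borel"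
proof (rule measurable_discrete_difference)
  let ?I = "interior (dens_support p)"
  show "(\<lambda>x. (1 / p x) * (indicator ?I x * deriv (\<lambda>y. f y * p y) x)) \<in> borel_measurable borel"
    using f by (intro borel_measurable_times borel_measurable_divide borel_measurable_const
        density_class_measurable[OF p] measurable_deriv_on_open) (auto simp: test_class_def)
  show "countable (dens_support p - ?I)"
    using finite_dens_support_boundary[OF p] by (rule countable_finite)
  show "(1 / p x) * (indicator ?I x * deriv (\<lambda>y. f y * p y) x) = stein_op p f x"
    if "x \<notin> dens_support p - ?I" for x
    using that interior_subset[of "dens_support p"]
    by (auto simp: stein_op_def indicator_def)
qed auto

section \<open>The mean of the Stein operator under the density itself\<close>

text \<open>
  The fundamental theorem for a derivative that is integrable but possibly discontinuous. On a
  compact subinterval any derivative has the expected Henstock-Kurzweil integral, which agrees with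
  the Lebesgue integral as soon as the latter exists; exhausting the interval gives the claim.
\<close>
lemma integral_derivative_einterval:
  fixes F f :: "real \<Rightarrow> real" and a b :: ereal
  assumes "a < b"
    and F: "\<And>x. a < ereal x \<Longrightarrow> ereal x < b \<Longrightarrow> (F has_real_derivative f x) (at x)"
    and f: "set_integrable lborel (einterval a b) f"
    and A: "((F \<circ> real_of_ereal) \<longlongrightarrow> A) (at_right a)"
    and B: "((F \<circ> real_of_ereal) \<longlongrightarrow> B) (at_left b)"
  shows "(LBINT x:einterval a b. f x) = B - A"
proof -
  obtain u l where approx:
    "einterval a b = (\<Union>i. {l i .. u i})"
    "incseq u" "decseq l" "\<And>i. l i < u i" "\<And>i. a < l i" "\<And>i. u i < b"
    "l \<longlonglongrightarrow> a" "u \<longlonglongrightarrow> b"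
    by (blast intro: einterval_Icc_approximation[OF \<open>a < b\<close>])
  have FTC: "(LBINT x=l i..u i. f x) = F (u i) - F (l i)" for i
  proof -
    have sub: "{l i..u i} \<subseteq> einterval a b"
      using approx(1) by auto
    have int: "set_integrable lborel {l i..u i} f"
      by (rule set_integrable_subset[OF f]) (use sub in auto)
    have "(f has_integral F (u i) - F (l i)) {l i..u i}"
    proof (rule fundamental_theorem_of_calculus)
      show "l i \<le> u i"
        using approx(4)[of i] by simp
      show "(F has_vector_derivative f x) (at x within {l i..u i})" if "x \<in> {l i..u i}" for x
      proof -
        have "x \<in> einterval a b"
          using sub that by blast
        then have "(F has_vector_derivative f x) (at x)"
          using F[of x] by (simp add: einterval_iff has_real_derivative_iff_has_vector_derivative)
        then show ?thesis
          by (rule has_vector_derivative_at_within)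
      qed
    qed
    then have "(LBINT x:{l i..u i}. f x) = F (u i) - F (l i)"
      using set_borel_integral_eq_integral(2)[OF int] by (simp add: integral_unique)
    then show ?thesis
      using approx(4)[of i] by (simp add: interval_integral_Icc)
  qed
  have "(\<lambda>i. LBINT x=l i..u i. f x) \<longlonglongrightarrow> B - A"
    unfolding FTC
  proof (intro tendsto_diff)
    show "(\<lambda>i. F (l i)) \<longlonglongrightarrow> A"
      using A approx unfolding tendsto_at_iff_sequentially comp_def
      by (elim allE[of _ "\<lambda>i. ereal (l i)"]) auto
    show "(\<lambda>i. F (u i)) \<longlonglongrightarrow> B"
      using B approx unfolding tendsto_at_iff_sequentially comp_def
      by (elim allE[of _ "\<lambda>i. ereal (u i)"]) auto
  qed
  moreover have "(\<lambda>i. LBINT x=l i..u i. f x) \<longlonglongrightarrow> (LBINT x=a..b. f x)"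
    by (rule interval_integral_Icc_approx_integrable[OF \<open>a < b\<close> approx f])
  ultimately have "(LBINT x=a..b. f x) = B - A"
    by (rule LIMSEQ_unique[THEN sym])
  then show ?thesis
    using \<open>a < b\<close> by (simp add: interval_lebesgue_integral_le_eq)
qed

lemma stein_identity:
  assumes p: "p \<in> density_class" and f: "f \<in> test_class p"
    and int: "integrable lborel (\<lambda>x. p x * stein_op p f x)"
  shows "(LINT x|lborel. p x * stein_op p f x) = 0"
proof -
  let ?F = "\<lambda>y. f y * p y"
  obtain a b where ab: "support_endpoints p a b"
    and A: "((?F \<circ> real_of_ereal) \<longlongrightarrow> 0) (at_right a)"
    and B: "((?F \<circ> real_of_ereal) \<longlongrightarrow> 0) (at_left b)"
    using f by (auto simp: test_class_def)
  note I = interior_dens_support[OF p ab]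

  have off: "p x * stein_op p f x = indicator (einterval a b) x *\<^sub>R deriv ?F x"
    if "x \<notin> dens_support p - interior (dens_support p)" for x
    using that interior_subset[of "dens_support p"] unfolding I
    by (auto simp: stein_op_def dens_support_def indicator_def)
  have AE: "AE x in lborel. p x * stein_op p f x = indicator (einterval a b) x *\<^sub>R deriv ?F x"
    using off
    by (intro AE_I'[OF finite_imp_null_set_lborel[OF finite_dens_support_boundary[OF p]]]) blast
  have meas: "(\<lambda>x. indicator (einterval a b) x *\<^sub>R deriv ?F x) \<in> borel_measurable lborel"
    using measurable_deriv_on_open[of "einterval a b" ?F] f
    by (simp add: test_class_def I)
  have "(LINT x|lborel. p x * stein_op p f x) = (LBINT x:einterval a b. deriv ?F x)"
    unfolding set_lebesgue_integral_def
    using int by (intro integral_cong_AE meas AE borel_measurable_integrable)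
  also have "\<dots> = 0 - 0"
  proof (rule integral_derivative_einterval[OF _ _ _ A B])
    show "a < b"
      using ab by (simp add: support_endpoints_def)
    show "(?F has_real_derivative deriv ?F x) (at x)" if "a < ereal x" "ereal x < b" for x
      using f that
      by (auto simp: test_class_def I einterval_iff DERIV_deriv_iff_real_differentiable)
    show "set_integrable lborel (einterval a b) (deriv ?F)"
      unfolding set_integrable_def using integrable_cong_AE_imp[OF int meas AE] .
  qed
  finally show ?thesis
    by simp
qed

section \<open>Solving the Stein equation\<close>

text \<open>
  Cutting the integral at an extended real lets a finite and an infinite end of the support be
  treated alike when limits are taken at the ends.
\<close>
lemma ereal_cut_integral_tendsto:
  fixes g :: "real \<Rightarrow> real" and X :: "nat \<Rightarrow> ereal"
  assumes g: "integrable lborel g"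
    and lim: "\<And>u. (\<lambda>n. indicator {v. ereal v \<le> X n} u :: real) \<longlonglongrightarrow> indicator A u"
    and [measurable]: "A \<in> sets borel"
  shows "(\<lambda>n. LINT u:{v. ereal v \<le> X n}|lborel. g u) \<longlonglongrightarrow> (LINT u:A|lborel. g u)"
  unfolding set_lebesgue_integral_def
proof (rule integral_dominated_convergence[where w = "\<lambda>u. norm (g u)"])
  have [measurable]: "g \<in> borel_measurable borel"
    using g by auto
  show "(\<lambda>u. indicator A u *\<^sub>R g u) \<in> borel_measurable lborel"
    by measurable
  show "(\<lambda>u. indicator {v. ereal v \<le> X n} u *\<^sub>R g u) \<in> borel_measurable lborel" for n
    by measurable
  show "AE u in lborel. (\<lambda>n. indicator {v. ereal v \<le> X n} u *\<^sub>R g u) \<longlonglongrightarrow> indicator A u *\<^sub>R g u"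
    by (intro AE_I2 tendsto_scaleR lim tendsto_const)
  show "AE u in lborel. norm (indicator {v. ereal v \<le> X n} u *\<^sub>R g u) \<le> norm (g u)" for n
    by (auto simp: indicator_def)
qed (use g in simp)

text \<open>
  The half-lines increase to an open half-line at \<open>b\<close> but decrease to a closed one at \<open>a\<close>;
  the former misses at most one point of \<open>[a, b]\<close>, the latter meets it in at most one.
\<close>
lemma ereal_cut_integral_limits:
  fixes g :: "real \<Rightarrow> real" and a b :: ereal
  assumes g: "integrable lborel g" and supp: "\<And>u. g u \<noteq> 0 \<Longrightarrow> a \<le> ereal u \<and> ereal u \<le> b"
  shows "((\<lambda>x. LINT u:{v. ereal v \<le> x}|lborel. g u) \<longlongrightarrow> 0) (at_right a)"
    and "((\<lambda>x. LINT u:{v. ereal v \<le> x}|lborel. g u) \<longlongrightarrow> (LINT u|lborel. g u)) (at_left b)"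
proof -
  have [measurable]: "g \<in> borel_measurable borel"
    using g by auto
  \<comment> \<open>If \<open>c\<close> is infinite, the point is \<open>0\<close>, which does no harm.\<close>
  have null: "{real_of_ereal c} \<in> null_sets lborel" for c
    by (simp add: finite_imp_null_set_lborel)
  have "AE u in lborel. indicator {v. ereal v \<le> a} u *\<^sub>R g u = 0"
    by (rule AE_I'[OF null[of a]]) (use supp in \<open>force simp: indicator_def\<close>)
  then have left: "(LINT u:{v. ereal v \<le> a}|lborel. g u) = 0"
    unfolding set_lebesgue_integral_def by (rule integral_eq_zero_AE)
  have "AE u in lborel. indicator {v. ereal v < b} u *\<^sub>R g u = g u"
    by (rule AE_I'[OF null[of b]]) (use supp in \<open>force simp: indicator_def\<close>)
  then have right: "(LINT u:{v. ereal v < b}|lborel. g u) = (LINT u|lborel. g u)"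
    unfolding set_lebesgue_integral_def by (intro integral_cong_AE) auto
  show "((\<lambda>x. LINT u:{v. ereal v \<le> x}|lborel. g u) \<longlongrightarrow> 0) (at_right a)"
    unfolding tendsto_at_iff_sequentially comp_def
  proof (intro allI impI)
    fix X assume X: "\<forall>i. X i \<in> {a<..} - {a}" "X \<longlonglongrightarrow> a"
    have "(\<lambda>n. LINT u:{v. ereal v \<le> X n}|lborel. g u) \<longlonglongrightarrow> (LINT u:{v. ereal v \<le> a}|lborel. g u)"
    proof (rule ereal_cut_integral_tendsto[OF g])
      show "(\<lambda>n. indicator {v. ereal v \<le> X n} u :: real) \<longlonglongrightarrow> indicator {v. ereal v \<le> a} u" for u
      proof (cases "ereal u \<le> a")
        case True
        then have "ereal u \<le> X n" for n
          using X(1) by (meson DiffD1 greaterThan_iff less_imp_le order_trans)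
        with True show ?thesis
          by simp
      next
        case False
        then have "\<forall>\<^sub>F n in sequentially. X n < ereal u"
          using X(2) by (simp add: order_tendstoD)
        then have "\<forall>\<^sub>F n in sequentially. (indicator {v. ereal v \<le> X n} u :: real) = indicator {v. ereal v \<le> a} u"
          by eventually_elim (use False in \<open>auto simp: indicator_def\<close>)
        then show ?thesis
          by (rule tendsto_eventually)
      qed
    qed measurable
    then show "(\<lambda>n. LINT u:{v. ereal v \<le> X n}|lborel. g u) \<longlonglongrightarrow> 0"
      by (simp add: left)
  qed
  show "((\<lambda>x. LINT u:{v. ereal v \<le> x}|lborel. g u) \<longlongrightarrow> (LINT u|lborel. g u)) (at_left b)"
    unfolding tendsto_at_iff_sequentially comp_def
  proof (intro allI impI)
    fix X assume X: "\<forall>i. X i \<in> {..<b} - {b}" "X \<longlonglongrightarrow> b"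
    have "(\<lambda>n. LINT u:{v. ereal v \<le> X n}|lborel. g u) \<longlonglongrightarrow> (LINT u:{v. ereal v < b}|lborel. g u)"
    proof (rule ereal_cut_integral_tendsto[OF g])
      show "(\<lambda>n. indicator {v. ereal v \<le> X n} u :: real) \<longlonglongrightarrow> indicator {v. ereal v < b} u" for u
      proof (cases "ereal u < b")
        case True
        then have "\<forall>\<^sub>F n in sequentially. ereal u < X n"
          using X(2) by (simp add: order_tendstoD)
        then have "\<forall>\<^sub>F n in sequentially. (indicator {v. ereal v \<le> X n} u :: real) = indicator {v. ereal v < b} u"
          by eventually_elim (use True in \<open>simp add: indicator_def\<close>)
        then show ?thesis
          by (rule tendsto_eventually)
      next
        case False
        then have "\<not> ereal u \<le> X n" for n
          using X(1) by (meson DiffD1 lessThan_iff le_less_trans)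
        with False show ?thesis
          by simp
      qed
    qed measurable
    then show "(\<lambda>n. LINT u:{v. ereal v \<le> X n}|lborel. g u) \<longlonglongrightarrow> (LINT u|lborel. g u)"
      by (simp add: right)
  qed
qed

lemma has_derivative_cut_integral:
  fixes g :: "real \<Rightarrow> real"
  assumes g: "integrable lborel g" and "open S" "x \<in> S" and cont: "continuous_on S g"
  shows "((\<lambda>y. LINT u:{..y}|lborel. g u) has_real_derivative g x) (at x)"
proof -
  obtain e where e: "e > 0" "cball x e \<subseteq> S"
    using \<open>open S\<close> \<open>x \<in> S\<close> open_contains_cball by blast
  let ?c = "x - e" and ?d = "x + e"
  have sub: "{?c..?d} \<subseteq> S"
    using e by (auto simp: cball_eq_atLeastAtMost)
  have setint: "set_integrable lborel A g" if "A \<in> sets borel" for A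
    unfolding set_integrable_def using g that by (intro integrable_mult_indicator) auto
  have "((\<lambda>y. LBINT u=?c..y. g u) has_vector_derivative g x) (at x within {?c..?d})"
    using e by (intro interval_integral_FTC2 continuous_on_subset[OF cont sub]) auto
  then have "((\<lambda>y. LBINT u=?c..y. g u) has_real_derivative g x) (at x)"
    using e at_within_Icc_at[of ?c x ?d] by (simp add: has_real_derivative_iff_has_vector_derivative)
  then have "((\<lambda>y. (LINT u:{..?c}|lborel. g u) + (LBINT u=?c..y. g u)) has_real_derivative g x) (at x)"
    by (auto intro!: derivative_eq_intros)
  then show ?thesis
  proof (rule has_field_derivative_transform_within_open)
    show "open {?c<..}" "x \<in> {?c<..}"
      using e by auto
    fix y assume y: "y \<in> {?c<..}"
    then have "{..y} = {..?c} \<union> {?c<..y}"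
      by auto
    then have "(LINT u:{..y}|lborel. g u) = (LINT u:{..?c}|lborel. g u) + (LINT u:{?c<..y}|lborel. g u)"
      by (simp only:) (intro set_integral_Un setint; auto)
    then show "(LINT u:{..?c}|lborel. g u) + (LBINT u=?c..y. g u) = (LINT u:{..y}|lborel. g u)"
      using y by (simp add: interval_integral_Ioc)
  qed
qed

text \<open>
  On the support, \<open>f p\<close> is the primitive \<open>G\<close> of \<open>g = (h - E[h X]) p\<close> that starts at zero at the
  left end. It also ends at zero, since subtracting the mean makes the total integral of \<open>g\<close>
  vanish. Continuity of \<open>h\<close> is what makes \<open>G\<close> differentiable everywhere in the interior.
\<close>
lemma stein_equation_solution:
  fixes h :: "real \<Rightarrow> real"
  assumes p: "p \<in> density_class"
    and cont: "continuous_on UNIV h" and bdd: "\<And>x. \<bar>h x\<bar> \<le> C"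
  obtains f where "f \<in> test_class p"
    and "\<And>x. x \<in> interior (dens_support p) \<Longrightarrow> stein_op p f x = h x - (LINT y|lborel. h y * p y)"
proof -
  obtain a b where ab: "support_endpoints p a b"
    and diff: "\<And>x. a < ereal x \<Longrightarrow> ereal x < b \<Longrightarrow> p differentiable (at x)"
    using p by (auto simp: density_class_def)
  note I = interior_dens_support[OF p ab]
  have "a < b"
    using ab by (simp add: support_endpoints_def)
  note [measurable] = density_class_measurable[OF p] borel_measurable_continuous_onI[OF cont]
  define m where "m = (LINT y|lborel. h y * p y)"
  define g where "g = (\<lambda>u. (h u - m) * p u)"
  define G where "G = (\<lambda>x. LINT u:{..x}|lborel. g u)"
  define f where "f = (\<lambda>x. G x / p x)"
  have hp: "integrable lborel (\<lambda>u. h u * p u)"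
  proof (rule Bochner_Integration.integrable_bound)
    show "integrable lborel (\<lambda>u. C * p u)"
      using density_class_integral(1)[OF p] by simp
    show "AE u in lborel. norm (h u * p u) \<le> norm (C * p u)"
    proof (rule AE_I2)
      fix u
      have "\<bar>h u\<bar> \<le> \<bar>C\<bar>"
        using bdd[of u] by simp
      then show "norm (h u * p u) \<le> norm (C * p u)"
        by (simp add: abs_mult mult_right_mono)
    qed
  qed simp
  have g: "integrable lborel g" "(LINT u|lborel. g u) = 0"
    using hp density_class_integral[OF p] by (auto simp: g_def left_diff_distrib m_def)
  have contg: "continuous_on (einterval a b) g"
    unfolding g_def
    by (intro continuous_intros continuous_on_subset[OF cont] continuous_at_imp_continuous_on ballI
          differentiable_imp_continuous_within diff) (auto simp: einterval_iff)
  have gsupp: "a \<le> ereal u \<and> ereal u \<le> b" if "g u \<noteq> 0" for u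
  proof -
    have "p u > 0"
      using that p by (auto simp: g_def density_class_def less_le)
    then show ?thesis
      using ab closure_subset[of "dens_support p"]
      by (auto simp: support_endpoints_def dens_support_def)
  qed
  have pos: "p x > 0" if "x \<in> einterval a b" for x
    using that interior_subset[of "dens_support p"] unfolding I by (auto simp: dens_support_def)
  have deriv: "((\<lambda>y. f y * p y) has_real_derivative g x) (at x)" if x: "x \<in> einterval a b" for x
  proof -
    have "(G has_real_derivative g x) (at x)"
      unfolding G_def by (rule has_derivative_cut_integral[OF g(1) open_einterval x contg])
    then show ?thesis
      by (rule has_field_derivative_transform_within_open[OF _ open_einterval x])
         (use pos in \<open>force simp: f_def\<close>)
  qed
  have G_ereal: "((\<lambda>x. f x * p x) \<circ> real_of_ereal) x = (LINT u:{v. ereal v \<le> x}|lborel. g u)"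
    if x: "a < x" "x < b" for x
  proof -
    obtain r where "x = ereal r"
      using x by (cases x) auto
    then show ?thesis
      using x pos[of r] by (simp add: f_def G_def einterval_iff atMost_def)
  qed
  have "(\<lambda>y. f y * p y) differentiable (at x)" if "x \<in> interior (dens_support p)" for x
    using deriv[of x] that by (auto simp: I real_differentiable_def)
  moreover have "(((\<lambda>x. f x * p x) \<circ> real_of_ereal) \<longlongrightarrow> 0) (at_right a)"
  proof (rule Lim_transform_eventually[OF ereal_cut_integral_limits(1)[OF g(1) gsupp]])
    show "\<forall>\<^sub>F x in at_right a. (LINT u:{v. ereal v \<le> x}|lborel. g u)
        = ((\<lambda>x. f x * p x) \<circ> real_of_ereal) x"
      using \<open>a < b\<close> G_ereal by (auto simp: eventually_at_right intro!: exI[of _ b])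
  qed
  moreover have "(((\<lambda>x. f x * p x) \<circ> real_of_ereal) \<longlongrightarrow> 0) (at_left b)"
  proof (rule Lim_transform_eventually[OF ereal_cut_integral_limits(2)[OF g(1) gsupp, unfolded g(2)]])
    show "\<forall>\<^sub>F x in at_left b. (LINT u:{v. ereal v \<le> x}|lborel. g u)
        = ((\<lambda>x. f x * p x) \<circ> real_of_ereal) x"
      using \<open>a < b\<close> G_ereal by (auto simp: eventually_at_left intro!: exI[of _ a])
  qed
  ultimately have "f \<in> test_class p"
    using ab unfolding test_class_def by blast
  moreover have "stein_op p f x = h x - (LINT y|lborel. h y * p y)" if "x \<in> interior (dens_support p)" for x
    using that[unfolded I] pos[of x] DERIV_imp_deriv[OF deriv[of x]]
    by (simp add: stein_op_def dens_support_def g_def m_def)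
  ultimately show ?thesis
    by (rule that)
qed

section \<open>Identifying laws on the real line\<close>

text \<open>
  The step that decreases from 1 at \<open>x\<close> to 0 at \<open>y\<close> lies between the indicators of the half-lines up
  to \<open>x\<close> and up to \<open>y\<close>. So the distribution function of either law at \<open>x\<close> is at most that of the
  other at every \<open>y > x\<close>, and hence also at \<open>x\<close> by right continuity.
\<close>
lemma real_distribution_eqI_cts_step:
  assumes M: "real_distribution M" and N: "real_distribution N"
    and eq: "\<And>x y. x < y \<Longrightarrow> (LINT u|M. cts_step x y u) = (LINT u|N. cts_step x y u)"
  shows "M = N"
proof -
  have le: "cdf M' x \<le> cdf N' x"
    if "real_distribution M'" "real_distribution N'"
      and eq: "\<And>x y. x < y \<Longrightarrow> (LINT u|M'. cts_step x y u) = (LINT u|N'. cts_step x y u)"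
    for M' N' x
  proof (rule tendsto_lowerbound)
    show "(cdf N' \<longlongrightarrow> cdf N' x) (at_right x)"
      using finite_borel_measure.cdf_is_right_cont[OF real_distribution.finite_borel_measure_M] that(2)
      by (simp add: continuous_within)
    have "cdf M' x \<le> cdf N' y" if "x < y" for y
      using real_distribution.cdf_cts_step[OF \<open>real_distribution M'\<close> that]
        real_distribution.cdf_cts_step[OF \<open>real_distribution N'\<close> that] eq[OF that] by simp
    then show "\<forall>\<^sub>F y in at_right x. cdf M' x \<le> cdf N' y"
      by (simp add: eventually_at_filter)
  qed simp
  have "cdf M = cdf N"
    by (intro ext antisym le M N eq eq[symmetric])
  then show ?thesis
    by (rule cdf_unique[OF M N])
qed

text \<open>
  A point outside the interval \<open>S\<close> lies to the left or to the right of all of it, and there both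
  distribution functions are 0 or 1, respectively.
\<close>
lemma real_distribution_eqI_on_interval:
  assumes M: "real_distribution M" and N: "real_distribution N"
    and S: "is_interval S" "S \<in> sets borel" "measure M S = 1" "measure N S = 1"
    and eq: "\<And>z. z \<in> S \<Longrightarrow> cdf M z = cdf N z"
  shows "M = N"
proof -
  have le: "cdf L z \<le> 0" if "measure L S = 1" "real_distribution L" "\<forall>s\<in>S. z < s" for L z
  proof -
    interpret L: real_distribution L by fact
    have "measure L {..z} + measure L S = measure L ({..z} \<union> S)"
      using that S by (intro L.finite_measure_Union[symmetric]) auto
    also have "\<dots> \<le> 1"
      by simp
    finally show ?thesis
      using that by (simp add: cdf_def)
  qed
  have ge: "1 \<le> cdf L z" if "measure L S = 1" "real_distribution L" "\<forall>s\<in>S. s < z" for L z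
  proof -
    interpret L: real_distribution L by fact
    have "measure L S \<le> measure L {..z}"
      using that by (intro L.finite_measure_mono) (auto simp: less_imp_le)
    then show ?thesis
      using that by (simp add: cdf_def)
  qed
  have cdf01: "0 \<le> cdf L z \<and> cdf L z \<le> 1" if "real_distribution L" for L z
    using that real_distribution.axioms(1)[OF that] by (simp add: cdf_def prob_space.prob_le_1)
  have "cdf M z = cdf N z" for z
  proof -
    consider "z \<in> S" | "\<forall>s\<in>S. z < s" | "\<forall>s\<in>S. s < z"
      using \<open>is_interval S\<close> unfolding is_interval_1 by (metis linorder_less_linear less_imp_le)
    then show ?thesis
    proof cases
      case 1
      then show ?thesis by (rule eq)
    next
      case 2
      then show ?thesis
        using le[OF S(3) M 2] le[OF S(4) N 2] cdf01[OF M, of z] cdf01[OF N, of z] by simp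
    next
      case 3
      then show ?thesis
        using ge[OF S(3) M 3] ge[OF S(4) N 3] cdf01[OF M, of z] cdf01[OF N, of z] by simp
    qed
  qed
  then show ?thesis
    by (intro cdf_unique[OF M N] ext)
qed

text \<open>For a function that vanishes off \<open>A\<close>, conditioning on \<open>A\<close> only rescales the integral.\<close>
lemma (in finite_measure) integral_uniform_measure:
  fixes f :: "'a \<Rightarrow> real"
  assumes A: "A \<in> sets M" "measure M A \<noteq> 0" and [measurable]: "f \<in> borel_measurable M"
    and off: "\<And>x. x \<in> space M \<Longrightarrow> x \<notin> A \<Longrightarrow> f x = 0"
  shows "integrable (uniform_measure M A) f \<longleftrightarrow> integrable M f"
    and "(LINT x|uniform_measure M A. f x) = (LINT x|M. f x) / measure M A"
proof -
  have [measurable]: "A \<in> sets M" by fact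
  have pos: "measure M A > 0"
    using A(2) by (simp add: zero_less_measure_iff)
  have eq: "uniform_measure M A = density M (\<lambda>x. ennreal (indicator A x / measure M A))"
    unfolding uniform_measure_def
    using pos
    by (intro density_cong) (auto simp: indicator_def emeasure_eq_measure divide_ennreal[symmetric])
  have scale: "indicator A x / measure M A * f x = f x / measure M A" if "x \<in> space M" for x
    using off[OF that] by (auto simp: indicator_def)
  have "integrable (uniform_measure M A) f \<longleftrightarrow> integrable M (\<lambda>x. indicator A x / measure M A * f x)"
    unfolding eq by (subst integrable_density) auto
  also have "\<dots> \<longleftrightarrow> integrable M (\<lambda>x. f x / measure M A)"
    by (intro Bochner_Integration.integrable_cong refl scale)
  also have "\<dots> \<longleftrightarrow> integrable M f"
    using A(2) by (simp add: divide_inverse)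
  finally show "integrable (uniform_measure M A) f \<longleftrightarrow> integrable M f" .
  have "(LINT x|uniform_measure M A. f x) = (LINT x|M. indicator A x / measure M A * f x)"
    unfolding eq by (subst integral_density) auto
  also have "\<dots> = (LINT x|M. f x / measure M A)"
    by (intro Bochner_Integration.integral_cong refl scale)
  finally show "(LINT x|uniform_measure M A. f x) = (LINT x|M. f x) / measure M A"
    by simp
qed

section \<open>The Stein characterization\<close>

theorem stein_characterization:
  assumes p: "p \<in> density_class" and Q: "real_distribution Q" and ac: "absolutely_continuous lborel Q"
    and pos: "measure Q (dens_support p) \<noteq> 0"
  shows "(\<forall>f\<in>test_class p. integrable Q (stein_op p f) \<longrightarrow> (LINT x|Q. stein_op p f x) = 0)
     \<longleftrightarrow> uniform_measure Q (dens_support p) = density lborel (\<lambda>x. ennreal (p x))"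
    (is "?stein \<longleftrightarrow> ?U = ?P")
proof -
  interpret Q: real_distribution Q by fact
  let ?S = "dens_support p"
  note [measurable] = density_class_measurable[OF p] dens_support_measurable[OF p]
  have nonneg: "0 \<le> p x" for x
    using p by (simp add: density_class_def)
  have off: "stein_op p f x = 0" if "x \<notin> ?S" for f x
    using that by (simp add: stein_op_def)
  show ?thesis
  proof
    assume eq: "?U = ?P"
    show ?stein
    proof (intro ballI impI)
      fix f assume f: "f \<in> test_class p" and int: "integrable Q (stein_op p f)"
      note [measurable] = stein_op_measurable[OF p f]
      have "integrable ?P (stein_op p f)"
        using int Q.integral_uniform_measure(1)[of ?S "stein_op p f"] pos off by (simp add: eq)
      then have "integrable lborel (\<lambda>x. p x * stein_op p f x)"
        using nonneg by (subst (asm) integrable_density) auto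
      then have "(LINT x|lborel. p x * stein_op p f x) = 0"
        by (rule stein_identity[OF p f])
      moreover have "(LINT x|?P. stein_op p f x) = (LINT x|lborel. p x * stein_op p f x)"
        using nonneg by (subst integral_density) auto
      ultimately have "(LINT x|?U. stein_op p f x) = 0"
        by (simp add: eq)
      then show "(LINT x|Q. stein_op p f x) = 0"
        using Q.integral_uniform_measure(2)[of ?S "stein_op p f"] pos off by simp
    qed
  next
    assume stein: ?stein
    have U: "real_distribution ?U"
      using pos Q.emeasure_eq_measure[of ?S]
      by (auto simp: real_distribution_def real_distribution_axioms_def intro!: prob_space_uniform_measure)
    interpret U: real_distribution ?U by (rule U)
    show "?U = ?P"
    proof (rule real_distribution_eqI_cts_step[OF U real_distribution_density_class(1)[OF p]])
      fix x y :: real assume "x < y"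
      let ?h = "cts_step x y"
      define m where "m = (LINT u|lborel. ?h u * p u)"
      have "continuous_on UNIV ?h"
        using cts_step_uniformly_continuous[OF \<open>x < y\<close>] uniformly_continuous_imp_continuous by blast
      note [measurable] = borel_measurable_continuous_onI[OF this]
      obtain f where f: "f \<in> test_class p"
        and solves: "\<And>u. u \<in> interior ?S \<Longrightarrow> stein_op p f u = ?h u - m"
      proof (rule stein_equation_solution[OF p \<open>continuous_on UNIV ?h\<close>])
        show "\<bar>?h u\<bar> \<le> 1" for u
          using \<open>x < y\<close> by (auto simp: cts_step_def)
      qed (auto simp: m_def)
      note [measurable] = stein_op_measurable[OF p f]
      let ?k = "\<lambda>u. indicator ?S u * (?h u - m)"
      \<comment> \<open>The Stein equation holds in the interior of the support, and \<open>Q\<close> does not charge the rest.\<close>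
      have "emeasure Q (?S - interior ?S) = 0"
        using finite_imp_null_set_lborel[OF finite_dens_support_boundary[OF p]]
        by (intro absolutely_continuousD[OF ac]) auto
      then have "AE u in Q. u \<notin> ?S - interior ?S"
        by (intro AE_not_in) auto
      then have AE: "AE u in Q. ?k u = stein_op p f u"
        by eventually_elim (auto simp: indicator_def solves off)
      have k: "integrable Q ?k"
        using Q.integrable_cts_step[OF \<open>x < y\<close>] integrable_mult_indicator[of ?S Q "\<lambda>u. ?h u - m"] by simp
      have "integrable Q (stein_op p f)"
        by (rule integrable_cong_AE_imp[OF k _ AE]) simp
      then have "(LINT u|Q. stein_op p f u) = 0"
        using stein f by blast
      then have "(LINT u|Q. ?k u) = 0"
        using integral_cong_AE[OF _ _ AE] by simp
      then have "(LINT u|?U. ?k u) = 0"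
        using Q.integral_uniform_measure(2)[of ?S ?k] pos by simp
      moreover have "AE u in ?U. ?k u = ?h u - m"
        by (intro AE_uniform_measureI) auto
      ultimately have "(LINT u|?U. ?h u - m) = 0"
        by (subst integral_cong_AE[where g = ?k]) auto
      then have "(LINT u|?U. ?h u) = m"
        using U.integrable_cts_step[OF \<open>x < y\<close>] U.prob_space by simp
      also have "\<dots> = (LINT u|?P. ?h u)"
        using nonneg by (subst integral_density) (auto simp: m_def mult.commute)
      finally show "(LINT u|?U. ?h u) = (LINT u|?P. ?h u)" .
    qed
  qed
qed

theorem corollary2p1:
  fixes M :: "'a measure" and X Y :: "'a \<Rightarrow> real" and p :: "real \<Rightarrow> real"
  assumes "prob_space M"
    and "p \<in> density_class"
    and "distributed M lborel X (\<lambda>x. ennreal (p x))"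
    and "Y \<in> borel_measurable M"
    and "absolutely_continuous lborel (distr M lborel Y)"
  shows "(\<forall>f \<in> test_class p. integrable M (\<lambda>\<omega>. stein_op p f (Y \<omega>)) \<longrightarrow>
            (LINT \<omega>|M. stein_op p f (Y \<omega>)) = 0)
     \<longleftrightarrow>
       (\<P>(\<omega> in M. Y \<omega> \<in> dens_support p) = 0 \<or>
        (\<P>(\<omega> in M. Y \<omega> \<in> dens_support p) > 0 \<and>
         (\<forall>z \<in> dens_support p.
            \<P>(\<omega> in M. Y \<omega> \<le> z \<bar> Y \<omega> \<in> dens_support p) = \<P>(\<omega> in M. X \<omega> \<le> z))))"
proof -
  interpret prob_space M by fact
  note p = assms(2)
  note [measurable] = dens_support_measurable[OF p] assms(4)
  let ?S = "dens_support p" and ?P = "density lborel (\<lambda>x. ennreal (p x))"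
  define Q where "Q = distr M borel Y"
  interpret Q: real_distribution Q
    unfolding Q_def by (intro real_distribution_distr) simp
  have ac: "absolutely_continuous lborel Q"
    using assms(5) by (simp add: Q_def cong: distr_cong)
  have QS: "measure Q ?S = \<P>(\<omega> in M. Y \<omega> \<in> ?S)"
    by (simp add: Q_def measure_distr vimage_def Int_def conj_commute)
  have stein_M: "(integrable M (\<lambda>\<omega>. stein_op p f (Y \<omega>)) \<longrightarrow> (LINT \<omega>|M. stein_op p f (Y \<omega>)) = 0)
      \<longleftrightarrow> (integrable Q (stein_op p f) \<longrightarrow> (LINT x|Q. stein_op p f x) = 0)" if "f \<in> test_class p" for f
    using stein_op_measurable[OF p that]
    by (simp add: Q_def integrable_distr_eq integral_distr)
  show ?thesis
  proof (cases "measure Q ?S = 0")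
    case True
    then have "AE x in Q. x \<notin> ?S"
      by (intro AE_not_in) (simp add: null_sets_def Q.emeasure_eq_measure)
    then have "AE x in Q. stein_op p f x = 0" for f
      by eventually_elim (simp add: stein_op_def)
    then have "(LINT x|Q. stein_op p f x) = 0" for f
      by (rule integral_eq_zero_AE)
    with True show ?thesis
      by (simp add: stein_M QS)
  next
    case False
    let ?U = "uniform_measure Q ?S"
    have U: "real_distribution ?U"
      using False Q.emeasure_eq_measure[of ?S]
      by (auto simp: real_distribution_def real_distribution_axioms_def intro!: prob_space_uniform_measure)
    have mU: "measure ?U A = measure Q (?S \<inter> A) / measure Q ?S" if "A \<in> sets borel" for A
      using that False by (simp add: Q.emeasure_eq_measure)
    have cdf_U: "cdf ?U z = \<P>(\<omega> in M. Y \<omega> \<le> z \<bar> Y \<omega> \<in> ?S)" for z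
    proof -
      have "measure Q (?S \<inter> {..z}) = \<P>(\<omega> in M. Y \<omega> \<le> z \<and> Y \<omega> \<in> ?S)"
        by (simp add: Q_def measure_distr vimage_def Int_def conj_ac)
      then show ?thesis
        by (simp add: cdf_def mU cond_prob_def QS)
    qed
    have cdf_P: "cdf ?P z = \<P>(\<omega> in M. X \<omega> \<le> z)" for z
    proof -
      have [measurable]: "X \<in> borel_measurable M"
        using distributed_measurable[OF assms(3)] by simp
      have "measure (distr M lborel X) {..z} = \<P>(\<omega> in M. X \<omega> \<le> z)"
        by (simp add: measure_distr vimage_def Int_def conj_commute)
      then show ?thesis
        by (simp add: cdf_def distributed_distr_eq_density[OF assms(3)])
    qed
    have "(?U = ?P) \<longleftrightarrow> (\<forall>z\<in>?S. cdf ?U z = cdf ?P z)"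
      using real_distribution_eqI_on_interval[OF U real_distribution_density_class(1)[OF p], of ?S]
        real_distribution_density_class(2)[OF p] mU[of ?S] False p
      by (auto simp: density_class_def)
    then show ?thesis
      using stein_characterization[OF p Q.real_distribution_axioms ac False] False
      by (simp add: stein_M cdf_U cdf_P QS zero_less_measure_iff)
  qed
qed

end
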